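(* Let $S=(1,1,2,2,2,\ldots)$, i.e. $a_1=a_2=1$ and $a_i=2$ for all $i\geq 3$, and let $n\geq 3$. Then $$\chi_S''(P_n)=\begin{cases}3, & n=3,\\ 4, & n\geq 4.\end{cases}$$
   Context: $P_n$ is the path on $n$ vertices. For vertices $u,v$ of a graph $G$, $d(u,v)$ is the usual shortest-path distance. For a vertex $u$ and an edge $ab$, $d(u,ab)=d(ab,u)=\min\{d(u,a),d(u,b)\}+1$. For two distinct edges $ab,cd$, $d(ab,cd)=\min\{d(a,c),d(a,d),d(b,c),d(b,d)\}+1$. For a non-decreasing infinite sequence $S=(a_1,a_2,\ldots)$ of positive integers, an $S$-packing total coloring of $G$ using $k$ colors is a map $c:V(G)\cup E(G)\to\{1,\ldots,k\}$ such that any two distinct elements $A,B\in V(G)\cup E(G)$ with $c(A)=c(B)=i$ satisfy $d(A,B)>a_i$. The $S$-packing total chromatic number $\chi_S''(G)$ is the smallest $k$ for which one exists. *)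

theory Defs
  imports "HOL-Library.Extended_Nat" "HOL-Library.FuncSet"
begin

text \<open>A finite simple graph is a pair of a vertex set and a set of two-element sets of vertices.\<close>

type_synonym 'a graph = "'a set \<times> 'a set set"

abbreviation verts :: "'a graph \<Rightarrow> 'a set" where "verts G \<equiv> fst G"
abbreviation edges :: "'a graph \<Rightarrow> 'a set set" where "edges G \<equiv> snd G"

definition simple_graph :: "'a graph \<Rightarrow> bool" where
  "simple_graph G \<longleftrightarrow> finite (verts G) \<and> (\<forall>e\<in>edges G. e \<subseteq> verts G \<and> card e = 2)"

definition is_path :: "'a graph \<Rightarrow> 'a \<Rightarrow> 'a list \<Rightarrow> 'a \<Rightarrow> bool" where
  "is_path G u p v \<longleftrightarrow>
     p \<noteq> [] \<and> hd p = u \<and> last p = v \<and> set p \<subseteq> verts G \<and> distinct p \<and>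
     (\<forall>i. Suc i < length p \<longrightarrow> {p ! i, p ! Suc i} \<in> edges G)"

text \<open>The length of a path is its number of edges; the distance of vertices that are not joined by a
  path is \<open>\<infinity>\<close>, the infimum of the empty set.\<close>

definition vdist :: "'a graph \<Rightarrow> 'a \<Rightarrow> 'a \<Rightarrow> enat" where
  "vdist G u v = (INF p\<in>{p. is_path G u p v}. enat (length p - 1))"

text \<open>An element of \<open>V(G) \<union> E(G)\<close> is \<open>Inl v\<close> for a vertex \<open>v\<close> or \<open>Inr e\<close> for an edge \<open>e\<close>. For an edge
  \<open>e = {a, b}\<close> the infimum over \<open>e\<close> is the minimum over the two endpoints. The last equation is only
  meaningful for distinct edges: it gives an edge distance 1 from itself.\<close>

fun elem_dist :: "'a graph \<Rightarrow> 'a + 'a set \<Rightarrow> 'a + 'a set \<Rightarrow> enat" where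
  "elem_dist G (Inl u) (Inl v) = vdist G u v"
| "elem_dist G (Inl u) (Inr e) = (INF a\<in>e. vdist G u a) + 1"
| "elem_dist G (Inr e) (Inl u) = (INF a\<in>e. vdist G u a) + 1"
| "elem_dist G (Inr e) (Inr f) = (INF a\<in>e. INF c\<in>f. vdist G a c) + 1"

text \<open>The sequence \<open>S = (a\<^sub>1, a\<^sub>2, \<dots>)\<close> is indexed from 1; the value \<open>S 0\<close> is never used because
  colors are positive.\<close>

definition packing_total_coloring ::
    "(nat \<Rightarrow> nat) \<Rightarrow> 'a graph \<Rightarrow> nat \<Rightarrow> ('a + 'a set \<Rightarrow> nat) \<Rightarrow> bool" where
  "packing_total_coloring S G k c \<longleftrightarrow>
     c \<in> (verts G <+> edges G) \<rightarrow> {1..k} \<and>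
     (\<forall>A \<in> verts G <+> edges G. \<forall>B \<in> verts G <+> edges G.
        A \<noteq> B \<and> c A = c B \<longrightarrow> elem_dist G A B > enat (S (c A)))"

definition packing_total_chromatic_number :: "(nat \<Rightarrow> nat) \<Rightarrow> 'a graph \<Rightarrow> nat" where
  "packing_total_chromatic_number S G = (LEAST k. \<exists>c. packing_total_coloring S G k c)"

definition path_graph :: "nat \<Rightarrow> nat graph" where
  "path_graph n = ({1..n}, {{i, Suc i} |i. 1 \<le> i \<and> i < n})"

lemma simple_graph_path_graph: "simple_graph (path_graph n)"
  by (auto simp: simple_graph_def path_graph_def)

end

theory Submission imports Defs
begin

text \<open>Listing the vertices and edges of a path in the order in which one meets them,
  \<open>v\<^sub>1, e\<^sub>1, v\<^sub>2, e\<^sub>2, \<dots>, v\<^sub>n\<close>, turns the problem into one about words: the distance of two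
  distinct elements at positions \<open>p\<close> and \<open>q\<close> of this list is half of \<open>\<bar>p - q\<bar>\<close>, rounded up
  (\<open>elem_dist_path_elem\<close>). Hence elements of equal color \<open>i\<close> satisfy the packing condition iff
  their positions differ by more than \<open>2 a\<^sub>i\<close> (\<open>packing_total_coloring_path_iff\<close>), that is, by at
  least 3 for the colors 1 and 2, and by at least 5 for all other colors.

  The word \<open>1 2 3 1 2 4\<close>, repeated periodically, satisfies these conditions, and its first five
  letters avoid the color 4; this gives the upper bounds. Conversely, any three consecutive positions
  have pairwise different colors, so two colors never suffice. If there are only three colors, then any three
  consecutive positions carry all of them, so any six consecutive positions carry the color 3
  twice, at positions that differ by exactly 3. The path on three vertices has only five positions,
  but every longer one has at least seven.\<close>

section \<open>Distances in a path graph\<close>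

text \<open>Along a path of the graph the vertex number changes by 1 in each step, so a path needs at
  least \<open>\<bar>u - v\<bar>\<close> steps.
  With truncated subtraction, \<open>(u - v) + (v - u)\<close> is \<open>\<bar>u - v\<bar>\<close>.\<close>

lemma path_graph_path_length_ge:
  assumes "is_path (path_graph n) u p v"
  shows "(u - v) + (v - u) \<le> length p - 1"
proof -
  have "(p ! 0 - p ! k) + (p ! k - p ! 0) \<le> k" if "k < length p" for k
    using that
  proof (induction k)
    case (Suc k)
    then have "{p ! k, p ! Suc k} \<in> edges (path_graph n)"
      using assms by (auto simp: is_path_def)
    then have "p ! Suc k = Suc (p ! k) \<or> p ! k = Suc (p ! Suc k)"
      by (auto simp: path_graph_def doubleton_eq_iff)
    then show ?case using Suc by auto
  qed simp
  moreover have "u = p ! 0" "v = p ! (length p - 1)" "length p - 1 < length p"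
    using assms by (auto simp: is_path_def hd_conv_nth last_conv_nth)
  ultimately show ?thesis
    by metis
qed

lemma is_path_rev:
  assumes "is_path G u p v"
  shows "is_path G v (rev p) u"
proof -
  have "{rev p ! i, rev p ! Suc i} \<in> edges G" if "Suc i < length p" for i
  proof -
    define j where "j = length p - Suc (Suc i)"
    have "rev p ! i = p ! Suc j" "rev p ! Suc i = p ! j" "Suc j < length p"
      using that by (auto simp: rev_nth j_def Suc_diff_Suc)
    then show ?thesis using assms by (auto simp: is_path_def insert_commute)
  qed
  then show ?thesis using assms by (auto simp: is_path_def hd_rev last_rev)
qed

lemma is_path_upt:
  assumes "1 \<le> u" "u \<le> v" "v \<le> n"
  shows "is_path (path_graph n) u [u..<Suc v] v"
  using assms by (auto simp: is_path_def path_graph_def simp del: upt_Suc)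

lemma vdist_path_graph:
  assumes "u \<in> {1..n}" "v \<in> {1..n}"
  shows "vdist (path_graph n) u v = enat ((u - v) + (v - u))"
proof -
  have "\<exists>p. is_path (path_graph n) u p v \<and> length p - 1 = (u - v) + (v - u)"
  proof (cases "u \<le> v")
    case True
    then show ?thesis using is_path_upt[of u v n] assms by (intro exI[of _ "[u..<Suc v]"]) auto
  next
    case False
    then show ?thesis using is_path_rev[OF is_path_upt[of v u n]] assms
      by (intro exI[of _ "rev [v..<Suc u]"]) auto
  qed
  then obtain p where p: "is_path (path_graph n) u p v" "length p - 1 = (u - v) + (v - u)"
    by blast
  show ?thesis unfolding vdist_def
  proof (rule antisym)
    show "(INF p\<in>{p. is_path (path_graph n) u p v}. enat (length p - 1)) \<le> enat ((u - v) + (v - u))"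
      using p by (intro INF_lower2[of p]) auto
    show "enat ((u - v) + (v - u)) \<le> (INF p\<in>{p. is_path (path_graph n) u p v}. enat (length p - 1))"
      using path_graph_path_length_ge by (intro INF_greatest) auto
  qed
qed

section \<open>Vertices and edges in linear order\<close>

text \<open>The vertex \<open>i\<close> gets position \<open>2 i\<close> and the edge from \<open>i\<close> to \<open>i + 1\<close> gets position \<open>2 i + 1\<close>, so
  that the elements of \<open>P\<^sub>n\<close> occupy the positions from \<open>2\<close> to \<open>2 n\<close>.\<close>

definition path_elem :: "nat \<Rightarrow> nat + nat set" where
  "path_elem p = (if even p then Inl (p div 2) else Inr {p div 2, Suc (p div 2)})"

text \<open>In both cases the position of an element is recovered as a sum: \<open>i + i\<close> for a vertex, and
  \<open>i + (i + 1)\<close>, the sum of the two ends, for an edge.\<close>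

fun elem_pos :: "nat + nat set \<Rightarrow> nat" where
  "elem_pos (Inl v) = v + v"
| "elem_pos (Inr e) = \<Sum>e"

lemma elem_pos_path_elem [simp]: "elem_pos (path_elem p) = p"
  by (auto simp: path_elem_def elim!: evenE oddE)

lemma path_elem_eq_iff [simp]: "path_elem p = path_elem q \<longleftrightarrow> p = q"
  by (metis elem_pos_path_elem)

lemma elements_path_graph:
  "verts (path_graph n) <+> edges (path_graph n) = path_elem ` {2..2 * n}"
proof (intro set_eqI iffI)
  fix A assume "A \<in> verts (path_graph n) <+> edges (path_graph n)"
  then consider i where "A = Inl i" "1 \<le> i" "i \<le> n"
    | i where "A = Inr {i, Suc i}" "1 \<le> i" "i < n"
    by (auto simp: path_graph_def)
  then show "A \<in> path_elem ` {2..2 * n}"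
  proof cases
    case 1
    then show ?thesis by (intro image_eqI[of _ _ "2 * i"]) (auto simp: path_elem_def)
  next
    case 2
    then show ?thesis by (intro image_eqI[of _ _ "2 * i + 1"]) (auto simp: path_elem_def)
  qed
next
  fix A assume "A \<in> path_elem ` {2..2 * n}"
  then show "A \<in> verts (path_graph n) <+> edges (path_graph n)"
    by (auto simp: path_graph_def path_elem_def elim!: evenE oddE)
qed

text \<open>With edges placed at their midpoints, \<open>\<bar>p - q\<bar> / 2\<close> is the distance along the path. Two
  midpoints are one step further apart than the nearest ends, which is what the summand 1 in the
  distance of two edges accounts for. A vertex is only half a step further from a midpoint than from
  the nearer end, but is charged a full step as well, hence the rounding up.\<close>

lemma elem_dist_path_elem:
  assumes "p \<in> {2..2 * n}" "q \<in> {2..2 * n}" "p \<noteq> q"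
  shows "elem_dist (path_graph n) (path_elem p) (path_elem q) =
    enat (((p - q) + (q - p) + 1) div 2)"
proof -
  define i j where "i = p div 2" and "j = q div 2"
  consider "p = 2 * i" "q = 2 * j" | "p = 2 * i" "q = 2 * j + 1"
    | "p = 2 * i + 1" "q = 2 * j" | "p = 2 * i + 1" "q = 2 * j + 1"
    unfolding i_def j_def by (metis even_two_times_div_two odd_two_times_div_two_succ)
  then show ?thesis
  proof cases
    case 1
    with assms show ?thesis
      by (simp add: path_elem_def vdist_path_graph)
  next
    case 2
    show ?thesis
    proof (cases "i \<le> j")
      case True
      then obtain m where "j = i + m"
        by (metis less_iff_Suc_add le_Suc_ex not_le add_Suc_right add_Suc)
      with 2 assms show ?thesis
        by (simp add: path_elem_def vdist_path_graph inf_min one_enat_def)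
    next
      case False
      then obtain m where "i = Suc (j + m)"
        by (metis less_iff_Suc_add le_Suc_ex not_le add_Suc_right add_Suc)
      with 2 assms show ?thesis
        by (simp add: path_elem_def vdist_path_graph inf_min one_enat_def)
    qed
  next
    case 3
    show ?thesis
    proof (cases "j \<le> i")
      case True
      then obtain m where "i = j + m"
        by (metis less_iff_Suc_add le_Suc_ex not_le add_Suc_right add_Suc)
      with 3 assms show ?thesis
        by (simp add: path_elem_def vdist_path_graph inf_min one_enat_def)
    next
      case False
      then obtain m where "j = Suc (i + m)"
        by (metis less_iff_Suc_add le_Suc_ex not_le add_Suc_right add_Suc)
      with 3 assms show ?thesis
        by (simp add: path_elem_def vdist_path_graph inf_min one_enat_def)
    qed
  next
    case 4
    show ?thesis
    proof (cases "i < j")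
      case True
      then obtain m where "j = Suc (i + m)"
        by (metis less_iff_Suc_add le_Suc_ex not_le add_Suc_right add_Suc)
      with 4 assms show ?thesis
        by (simp add: path_elem_def vdist_path_graph inf_min one_enat_def)
    next
      case False
      then obtain m where "i = j + m"
        by (metis less_iff_Suc_add le_Suc_ex not_le add_Suc_right add_Suc)
      with 4 assms show ?thesis
        by (simp add: path_elem_def vdist_path_graph inf_min one_enat_def)
    qed
  qed
qed

text \<open>Half of \<open>q - p\<close>, rounded up, exceeds \<open>s\<close> exactly if \<open>q - p > 2 s\<close>.\<close>

lemma packing_total_coloring_path_iff:
  "packing_total_coloring S (path_graph n) k c \<longleftrightarrow>
    (\<forall>p \<in> {2..2 * n}. c (path_elem p) \<in> {1..k}) \<and>
    (\<forall>p q. 2 \<le> p \<and> p < q \<and> q \<le> 2 * n \<and> c (path_elem p) = c (path_elem q) \<longrightarrow>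
      2 * S (c (path_elem p)) < q - p)"
    (is "?L \<longleftrightarrow> ?range \<and> ?sep")
proof -
  let ?sep' = "\<forall>p \<in> {2..2 * n}. \<forall>q \<in> {2..2 * n}. p \<noteq> q \<and> c (path_elem p) = c (path_elem q) \<longrightarrow>
      enat (S (c (path_elem p))) < elem_dist (path_graph n) (path_elem p) (path_elem q)"
  have half: "s < (d + 1) div 2 \<longleftrightarrow> 2 * s < d" for s d :: nat
    by arith
  have "?L \<longleftrightarrow> ?range \<and> ?sep'"
    unfolding packing_total_coloring_def elements_path_graph by (auto simp: Pi_iff)
  also have "?sep' \<longleftrightarrow> (\<forall>p \<in> {2..2 * n}. \<forall>q \<in> {2..2 * n}.
      p \<noteq> q \<and> c (path_elem p) = c (path_elem q) \<longrightarrow> 2 * S (c (path_elem p)) < (p - q) + (q - p))"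
    by (simp add: elem_dist_path_elem half del: One_nat_def add_Suc_right cong: conj_cong)
  also have "\<dots> \<longleftrightarrow> ?sep"
  proof (intro iffI ballI impI allI)
    fix p q
    assume sep: ?sep and "p \<in> {2..2 * n}" "q \<in> {2..2 * n}"
      "p \<noteq> q \<and> c (path_elem p) = c (path_elem q)"
    then show "2 * S (c (path_elem p)) < (p - q) + (q - p)"
      using sep[rule_format, of p q] sep[rule_format, of q p] by (cases "p < q") auto
  next
    fix p q
    assume sep: "\<forall>p \<in> {2..2 * n}. \<forall>q \<in> {2..2 * n}. p \<noteq> q \<and> c (path_elem p) = c (path_elem q) \<longrightarrow>
      2 * S (c (path_elem p)) < (p - q) + (q - p)"
      and "2 \<le> p \<and> p < q \<and> q \<le> 2 * n \<and> c (path_elem p) = c (path_elem q)"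
    then show "2 * S (c (path_elem p)) < q - p"
      using sep[rule_format, of p q] by auto
  qed
  finally show ?thesis .
qed

section \<open>Upper bounds\<close>

text \<open>The periodic word \<open>1 2 3 1 2 4\<close>, with its first letter at position 2.\<close>

definition color_word :: "nat \<Rightarrow> nat" where
  "color_word p = (if p mod 3 = 2 then 1 else if p mod 3 = 0 then 2
    else if p mod 6 = 4 then 3 else 4)"

lemma color_word_separated:
  assumes "p < q" "color_word p = color_word q"
  shows "3 \<le> q - p" and "3 \<le> color_word p \<Longrightarrow> 6 \<le> q - p"
proof -
  \<comment> \<open>The color of a position determines the position modulo 3, and from the color 3 on even
    modulo 6.\<close>
  have mod3: "r mod 3 = (if color_word r = 1 then 2 else if color_word r = 2 then 0 else 1)" for r
  proof -
    have "r mod 3 = 0 \<or> r mod 3 = 1 \<or> r mod 3 = 2" by presburger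
    then show ?thesis by (elim disjE) (simp_all add: color_word_def)
  qed
  have mod6: "r mod 6 = (if color_word r = 3 then 4 else 1)" if "3 \<le> color_word r" for r
  proof -
    have "r mod 3 = 1" using mod3[of r] that by simp
    then have "r mod 6 = 4 \<or> r mod 6 = 1" by presburger
    then show ?thesis using \<open>r mod 3 = 1\<close> by (elim disjE) (simp_all add: color_word_def)
  qed
  have "p mod 3 = q mod 3"
    using assms(2) by (simp only: mod3)
  then have "3 dvd q - p"
    using assms(1) by (metis mod_eq_dvd_iff_nat less_imp_le)
  then show "3 \<le> q - p"
    using assms(1) by (intro dvd_imp_le) auto
  show "6 \<le> q - p" if "3 \<le> color_word p"
  proof -
    have "p mod 6 = q mod 6"
      using assms(2) that mod6[of p] mod6[of q] by metis
    then have "6 dvd q - p"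
      using assms(1) by (metis mod_eq_dvd_iff_nat less_imp_le)
    then show ?thesis
      using assms(1) by (intro dvd_imp_le) auto
  qed
qed

lemma packing_total_coloring_color_word:
  assumes S: "S 1 = 1" "S 2 = 1" "\<And>i. i \<ge> 3 \<Longrightarrow> S i = 2"
    and range: "\<And>p. p \<in> {2..2 * n} \<Longrightarrow> color_word p \<le> k"
  shows "packing_total_coloring S (path_graph n) k (color_word \<circ> elem_pos)"
proof -
  have "2 * S (color_word p) < q - p" if "p < q" "color_word p = color_word q" for p q
  proof (cases "3 \<le> color_word p")
    case True
    then show ?thesis using color_word_separated(2)[OF that] S(3) by simp
  next
    case False
    then have "S (color_word p) = 1"
      using S(1,2) by (auto simp: color_word_def)
    then show ?thesis using color_word_separated(1)[OF that] by simp
  qed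
  moreover have "1 \<le> color_word p" for p
    by (simp add: color_word_def)
  ultimately show ?thesis
    using range by (auto simp: packing_total_coloring_path_iff)
qed

section \<open>Lower bounds\<close>

lemma consecutive_colors_distinct:
  assumes col: "packing_total_coloring S (path_graph n) k c"
    and S: "\<And>i. i \<ge> 1 \<Longrightarrow> S i \<ge> 1"
    and "2 \<le> p" "p < q" "q \<le> p + 2" "q \<le> 2 * n"
  shows "c (path_elem p) \<noteq> c (path_elem q)"
proof
  assume "c (path_elem p) = c (path_elem q)"
  then have "2 * S (c (path_elem p)) < q - p" "c (path_elem p) \<ge> 1"
    using col assms(3-6) by (auto simp: packing_total_coloring_path_iff)
  then show False using S[of "c (path_elem p)"] assms(5) by linarith
qed

lemma packing_total_coloring_path_ge_3:
  assumes col: "packing_total_coloring S (path_graph n) k c"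
    and S: "\<And>i. i \<ge> 1 \<Longrightarrow> S i \<ge> 1" and "n \<ge> 2"
  shows "k \<ge> 3"
proof -
  have "c (path_elem p) \<in> {1..k}" if "p \<in> {2, 3, 4}" for p
    using col that \<open>n \<ge> 2\<close> by (auto simp: packing_total_coloring_path_iff)
  from this[of 2] this[of 3] this[of 4] show ?thesis
    using consecutive_colors_distinct[OF col S, of 2 3] consecutive_colors_distinct[OF col S, of 2 4]
      consecutive_colors_distinct[OF col S, of 3 4] \<open>n \<ge> 2\<close>
    by auto
qed

text \<open>With three colors, the color 3 occurs at some position \<open>p \<le> 4\<close>. The positions \<open>p + 1\<close> and
  \<open>p + 2\<close> then carry the colors 1 and 2, which forces the color 3 again at position \<open>p + 3 \<le> 7\<close>,
  too close to \<open>p\<close>.\<close>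

lemma packing_total_coloring_path_ge_4:
  assumes col: "packing_total_coloring S (path_graph n) k c"
    and S: "\<And>i. i \<ge> 1 \<Longrightarrow> S i \<ge> 1" and S3: "S 3 \<ge> 2" and "n \<ge> 4"
  shows "k \<ge> 4"
proof (rule ccontr)
  assume "\<not> k \<ge> 4"
  then have range: "c (path_elem p) \<in> {1, 2, 3}" if "2 \<le> p" "p \<le> 8" for p
  proof -
    have "c (path_elem p) \<in> {1..k}"
      using col that \<open>n \<ge> 4\<close> by (simp add: packing_total_coloring_path_iff)
    then show ?thesis using \<open>\<not> k \<ge> 4\<close> by auto
  qed
  have distinct: "c (path_elem p) \<noteq> c (path_elem (p + 1))" "c (path_elem p) \<noteq> c (path_elem (p + 2))"
      "c (path_elem (p + 1)) \<noteq> c (path_elem (p + 2))" if "2 \<le> p" "p \<le> 6" for p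
    using that \<open>n \<ge> 4\<close> by (intro consecutive_colors_distinct[OF col S]; simp)+
  have "\<exists>p. 2 \<le> p \<and> p \<le> 4 \<and> c (path_elem p) = 3"
  proof -
    have "c (path_elem 2) = 3 \<or> c (path_elem 3) = 3 \<or> c (path_elem 4) = 3"
      using range[of 2] range[of 3] range[of 4] distinct[of 2] by auto
    moreover have "(2::nat) \<le> 3" "(3::nat) \<le> 4" "(2::nat) \<le> 4" by simp_all
    ultimately show ?thesis by blast
  qed
  then obtain p where p: "2 \<le> p" "p \<le> 4" "c (path_elem p) = 3"
    by blast
  then have "c (path_elem (p + 3)) = 3"
    using range[of "p + 1"] range[of "p + 2"] range[of "p + 3"] distinct[of p] distinct[of "p + 1"]
    by (auto simp: numeral_eq_Suc)
  moreover have "2 * S (c (path_elem p)) < (p + 3) - p" if "c (path_elem p) = c (path_elem (p + 3))"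
    using col[unfolded packing_total_coloring_path_iff, THEN conjunct2, rule_format, of p "p + 3"]
      that p(1,2) \<open>n \<ge> 4\<close> by simp
  ultimately have "2 * S 3 < 3"
    using p(3) by simp
  then show False using S3 by simp
qed

section \<open>The packing total chromatic number of a path\<close>

theorem proposition13:
  fixes S :: "nat \<Rightarrow> nat" and n :: nat
  assumes "S 1 = 1" and "S 2 = 1" and "\<And>i. i \<ge> 3 \<Longrightarrow> S i = 2"
    and "n \<ge> 3"
  shows "packing_total_chromatic_number S (path_graph n) = (if n = 3 then 3 else 4)"
proof -
  have S: "S i \<ge> 1" if "i \<ge> 1" for i
  proof -
    from that consider "i = 1" | "i = 2" | "i \<ge> 3" by linarith
    then show ?thesis using assms(1-3) by cases auto
  qed
  have "color_word p \<le> (if n = 3 then 3 else 4)" if "p \<in> {2..2 * n}" for p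
  proof (cases "n = 3")
    case True
    \<comment> \<open>The color 4 first occurs at position 7, and \<open>P\<^sub>3\<close> ends at position 6.\<close>
    then have "p \<in> {2, 3, 4, 5, 6}" using that by auto
    then show ?thesis using True by (auto simp: color_word_def)
  qed (simp add: color_word_def)
  then have "packing_total_coloring S (path_graph n) (if n = 3 then 3 else 4) (color_word \<circ> elem_pos)"
    using assms(1-3) by (intro packing_total_coloring_color_word) auto
  moreover have "(if n = 3 then 3 else 4) \<le> k"
    if "packing_total_coloring S (path_graph n) k c" for k c
    using packing_total_coloring_path_ge_3[OF that S] packing_total_coloring_path_ge_4[OF that S]
      assms(3)[of 3] \<open>n \<ge> 3\<close> by auto
  ultimately show ?thesis
    unfolding packing_total_chromatic_number_def by (intro Least_equality) blast+
qed

end
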